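(* Let $T$ be an i.e.m. with no connection whose rotation number satisfies condition (a'). Then for any $\tau>0$ there exists $C_\tau>0$ such that, for any $\alpha\in\mathcal A$ and any $n\ge0$, $$|I_\alpha^{(n)}|\le C_\tau\,|I^{(0)}|\,\|B(0,n)\|^{-1+\tau}.$$
   Context: Let $\mathcal A$ be an alphabet with $d\ge2$ letters and $\pi=(\pi_t,\pi_b)$ an irreducible pair of bijections $\mathcal A\to\{1,\dots,d\}$ (irreducible: $\pi_t^{-1}(\{1,\dots,k\})\ne\pi_b^{-1}(\{1,\dots,k\})$ for $1\le k<d$). For $\lambda\in(0,\infty)^{\mathcal A}$ the interval exchange map (i.e.m.) $T=T_{\pi,\lambda}$ acts on $I=(u_0,u_d)$ of length $\sum_\alpha\lambda_\alpha$: it translates open intervals $I_\alpha$ of length $\lambda_\alpha$, ordered from left to right by $\pi_t$, onto intervals $I_\alpha^b$ of the same lengths ordered by $\pi_b$ (extended by right-continuity). The points separating the $I_\alpha$ (resp. $I_\alpha^b$) are $u_1^t<\dots<u_{d-1}^t$ (resp. $u_1^b<\dots<u_{d-1}^b$). $T$ has no connection if there are no $i,j$, $m\ge0$ with $T^m(u_j^b)=u_i^t$. $\Omega_\pi$ is the antisymmetric matrix with $\Omega_{\alpha\beta}=1$ if $\pi_t(\alpha)<\pi_t(\beta),\pi_b(\alpha)>\pi_b(\beta)$, $-1$ if $\pi_t(\alpha)>\pi_t(\beta),\pi_b(\alpha)<\pi_b(\beta)$, $0$ otherwise; $H(\pi)$ is its image. Rauzy--Veech algorithm. For $T$ with no connection,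 with $\pi_t(\alpha_t)=\pi_b(\alpha_b)=d$, an elementary step replaces $T$ by its first return map to $(u_0,\max(u_{d-1}^t,u_{d-1}^b))$, again an i.e.m. with no connection labelled by $\mathcal A$; the winner/loser are $\alpha_t/\alpha_b$ if $u_{d-1}^t<u_{d-1}^b$ and $\alpha_b/\alpha_t$ otherwise, and the matrix of the step is $B_\gamma=\mathrm{Id}+E_{\text{loser},\text{winner}}$. Iterating from $T=T^{(0)}$ gives i.e.m.'s $T^{(n)}$ with data $\pi^{(n)}$ on intervals $I^{(n)}$, exchanging $I_\alpha^{(n)}$; the rotation number is the path $\gamma_1\star\gamma_2\star\cdots$ of successive steps and $B(m,n)=B_{\gamma_n}\cdots B_{\gamma_{m+1}}$. $\|B\|=\max_\alpha\sum_\beta|B_{\alpha\beta}|$. Condition (a'): let $\mathcal C=(0,\infty)^{\mathcal A}$, $\mathcal C(\pi)=\mathcal C\cap H(\pi)$, $n_0=0$, and $n_k$ the smallest $n>n_{k-1}$ such that $\overline{B(n_{k-1},n)(\mathcal C(\pi^{(n_{k-1})}))}\subset\mathcal C(\pi^{(n)})\cup\{0\}$; then for all $\tau>0$ there is $C_\tau>0$ with $\|B(n_{k-1},n_k)\|\le C_\tau\|B(n_0,n_{k-1})\|^\tau$ for all $k>0$. *)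

theory Defs
  imports "HOL-Analysis.Analysis"
begin

text \<open>The alphabet is a finite type \<open>'a\<close>, and \<open>d = CARD('a)\<close>.  A pair \<open>(p, q)\<close> of maps
  from \<open>'a\<close> to \<open>nat\<close> stands for \<open>(\<pi>\<^sub>t, \<pi>\<^sub>b)\<close>.\<close>

type_synonym 'a pair_data = "('a \<Rightarrow> nat) \<times> ('a \<Rightarrow> nat)"

definition irreducible_pair :: "'a::finite pair_data \<Rightarrow> bool" where
  "irreducible_pair \<pi> \<longleftrightarrow>
     bij_betw (fst \<pi>) UNIV {1..CARD('a)} \<and> bij_betw (snd \<pi>) UNIV {1..CARD('a)} \<and>
     (\<forall>k. 1 \<le> k \<and> k < CARD('a) \<longrightarrow> fst \<pi> -` {1..k} \<noteq> snd \<pi> -` {1..k})"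

definition Omega :: "'a::finite pair_data \<Rightarrow> real^'a^'a" where
  "Omega \<pi> = (\<chi> \<alpha> \<beta>.
     if fst \<pi> \<alpha> < fst \<pi> \<beta> \<and> snd \<pi> \<alpha> > snd \<pi> \<beta> then 1
     else if fst \<pi> \<alpha> > fst \<pi> \<beta> \<and> snd \<pi> \<alpha> < snd \<pi> \<beta> then -1
     else 0)"

definition H_image :: "'a::finite pair_data \<Rightarrow> (real^'a) set" where
  "H_image \<pi> = range (\<lambda>v. Omega \<pi> *v v)"

definition positive_cone :: "(real^'a::finite) set" where
  "positive_cone = {v. \<forall>\<alpha>. v $ \<alpha> > 0}"

definition cone_of :: "'a::finite pair_data \<Rightarrow> (real^'a) set" where
  "cone_of \<pi> = positive_cone \<inter> H_image \<pi>"

record 'a iem =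
  base :: real
  perm :: "'a pair_data"
  len :: "'a \<Rightarrow> real"

definition is_iem :: "'a::finite iem \<Rightarrow> bool" where
  "is_iem S \<longleftrightarrow> irreducible_pair (perm S) \<and> (\<forall>\<alpha>. len S \<alpha> > 0)"

definition total_len :: "'a::finite iem \<Rightarrow> real" where
  "total_len S = (\<Sum>\<alpha>\<in>UNIV. len S \<alpha>)"

text \<open>\<open>u_top S i\<close> and \<open>u_bot S i\<close> are the points \<open>u\<^sub>i\<^sup>t\<close> and \<open>u\<^sub>i\<^sup>b\<close>; for \<open>i = 0\<close> and \<open>i = d\<close> both
  give the end points of the interval.\<close>

definition u_top :: "'a::finite iem \<Rightarrow> nat \<Rightarrow> real" where
  "u_top S i = base S + (\<Sum>\<alpha> | fst (perm S) \<alpha> \<le> i. len S \<alpha>)"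

definition u_bot :: "'a::finite iem \<Rightarrow> nat \<Rightarrow> real" where
  "u_bot S i = base S + (\<Sum>\<alpha> | snd (perm S) \<alpha> \<le> i. len S \<alpha>)"

text \<open>Extension by right-continuity amounts to working with intervals that contain their left
  end point.\<close>

definition I_top :: "'a::finite iem \<Rightarrow> 'a \<Rightarrow> real set" where
  "I_top S \<alpha> = {u_top S (fst (perm S) \<alpha> - 1) ..< u_top S (fst (perm S) \<alpha>)}"

text \<open>The map is only meaningful on \<open>{u_top S 0 ..< u_top S d}\<close>, which it maps to itself.\<close>

definition iem_map :: "'a::finite iem \<Rightarrow> real \<Rightarrow> real" where
  "iem_map S x = (let \<alpha> = (THE \<alpha>. x \<in> I_top S \<alpha>)
     in x + (u_bot S (snd (perm S) \<alpha> - 1) - u_top S (fst (perm S) \<alpha> - 1)))"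

definition no_connection :: "'a::finite iem \<Rightarrow> bool" where
  "no_connection S \<longleftrightarrow>
     \<not> (\<exists>i\<in>{1..<CARD('a)}. \<exists>j\<in>{1..<CARD('a)}. \<exists>m. (iem_map S ^^ m) (u_bot S j) = u_top S i)"

datatype arrow_type = Top | Bot

text \<open>An arrow of the Rauzy diagram is determined by its source and its type, which says
  whether the winner is \<open>\<alpha>\<^sub>t\<close> or \<open>\<alpha>\<^sub>b\<close>.\<close>

type_synonym 'a arrow = "'a pair_data \<times> arrow_type"

definition last_top :: "'a::finite pair_data \<Rightarrow> 'a" where
  "last_top \<pi> = (THE \<alpha>. fst \<pi> \<alpha> = CARD('a))"

definition last_bot :: "'a::finite pair_data \<Rightarrow> 'a" where
  "last_bot \<pi> = (THE \<alpha>. snd \<pi> \<alpha> = CARD('a))"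

definition winner :: "'a::finite arrow \<Rightarrow> 'a" where
  "winner a = (case snd a of Top \<Rightarrow> last_top (fst a) | Bot \<Rightarrow> last_bot (fst a))"

definition loser :: "'a::finite arrow \<Rightarrow> 'a" where
  "loser a = (case snd a of Top \<Rightarrow> last_bot (fst a) | Bot \<Rightarrow> last_top (fst a))"

definition arrow_matrix :: "'a::finite arrow \<Rightarrow> real^'a^'a" where
  "arrow_matrix a = mat 1 + (\<chi> \<alpha> \<beta>. if \<alpha> = loser a \<and> \<beta> = winner a then 1 else 0)"

definition arrow_of :: "'a::finite iem \<Rightarrow> 'a arrow" where
  "arrow_of S = (perm S,
     if u_top S (CARD('a) - 1) < u_bot S (CARD('a) - 1) then Top else Bot)"

definition return_time :: "(real \<Rightarrow> real) \<Rightarrow> real set \<Rightarrow> real \<Rightarrow> nat" where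
  "return_time f J x = (LEAST m. m > 0 \<and> (f ^^ m) x \<in> J)"

definition first_return :: "(real \<Rightarrow> real) \<Rightarrow> real set \<Rightarrow> real \<Rightarrow> real" where
  "first_return f J x = (f ^^ return_time f J x) x"

text \<open>\<open>S'\<close> is the first return map of \<open>S\<close> to the shortened interval \<open>J\<close>.  The last conjunct
  fixes the labelling of its intervals: the entry at \<open>(\<alpha>, \<beta>)\<close> of the matrix of the step is the
  number of visits of the new interval \<open>\<alpha>\<close> to the old interval \<open>\<beta>\<close> before returning to \<open>J\<close>.
  The rows of this matrix are pairwise distinct, so there is only one such labelling.\<close>

definition rauzy_step :: "'a::finite iem \<Rightarrow> 'a iem \<Rightarrow> bool" where
  "rauzy_step S S' \<longleftrightarrow>
     (let e = max (u_top S (CARD('a) - 1)) (u_bot S (CARD('a) - 1));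
          J = {base S ..< e}
      in is_iem S' \<and> base S' = base S \<and> u_top S' CARD('a) = e \<and>
         (\<forall>x\<in>J. iem_map S' x = first_return (iem_map S) J x) \<and>
         (\<forall>\<alpha> \<beta>. \<forall>x\<in>I_top S' \<alpha>.
            real (card {j. j < return_time (iem_map S) J x \<and> (iem_map S ^^ j) x \<in> I_top S \<beta>})
              = arrow_matrix (arrow_of S) $ \<alpha> $ \<beta>))"

text \<open>Paths are indexed from 0: \<open>\<gamma> n\<close> is the arrow from \<open>\<pi>\<close> at time \<open>n\<close> to \<open>\<pi>\<close> at time \<open>n + 1\<close>,
  that is, the arrow usually written \<open>\<gamma>\<close> with index \<open>n + 1\<close>.\<close>

definition rotation_number :: "(nat \<Rightarrow> 'a::finite iem) \<Rightarrow> nat \<Rightarrow> 'a arrow" where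
  "rotation_number T n = arrow_of (T n)"

text \<open>\<open>B_mat \<gamma> m n\<close> is the product of the matrices of the steps from time \<open>m\<close> to time \<open>n\<close>, later
  steps on the left.  It is the identity for \<open>n \<le> m\<close>.\<close>

primrec B_mat :: "(nat \<Rightarrow> 'a::finite arrow) \<Rightarrow> nat \<Rightarrow> nat \<Rightarrow> real^'a^'a" where
  "B_mat \<gamma> m 0 = mat 1"
| "B_mat \<gamma> m (Suc n) = (if m \<le> n then arrow_matrix (\<gamma> n) ** B_mat \<gamma> m n else mat 1)"

definition mat_norm :: "real^'a::finite^'a \<Rightarrow> real" where
  "mat_norm A = Max (range (\<lambda>\<alpha>. \<Sum>\<beta>\<in>UNIV. \<bar>A $ \<alpha> $ \<beta>\<bar>))"

definition contracts :: "(nat \<Rightarrow> 'a::finite arrow) \<Rightarrow> nat \<Rightarrow> nat \<Rightarrow> bool" where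
  "contracts \<gamma> m n \<longleftrightarrow>
     closure ((\<lambda>v. B_mat \<gamma> m n *v v) ` cone_of (fst (\<gamma> m))) \<subseteq> cone_of (fst (\<gamma> n)) \<union> {0}"

definition contraction_times :: "(nat \<Rightarrow> 'a::finite arrow) \<Rightarrow> (nat \<Rightarrow> nat) \<Rightarrow> bool" where
  "contraction_times \<gamma> \<nu> \<longleftrightarrow> \<nu> 0 = 0 \<and>
     (\<forall>k. \<nu> k < \<nu> (Suc k) \<and> contracts \<gamma> (\<nu> k) (\<nu> (Suc k)) \<and>
          (\<forall>n. \<nu> k < n \<and> n < \<nu> (Suc k) \<longrightarrow> \<not> contracts \<gamma> (\<nu> k) n))"

definition condition_a' :: "(nat \<Rightarrow> 'a::finite arrow) \<Rightarrow> bool" where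
  "condition_a' \<gamma> \<longleftrightarrow>
     (\<exists>\<nu>. contraction_times \<gamma> \<nu> \<and>
       (\<forall>\<tau>>0. \<exists>C>0. \<forall>k>0.
          mat_norm (B_mat \<gamma> (\<nu> (k - 1)) (\<nu> k)) \<le> C * mat_norm (B_mat \<gamma> (\<nu> 0) (\<nu> (k - 1))) powr \<tau>))"

end

theory Submission imports Defs begin

text \<open>
  The entry at \<open>(\<alpha>, \<beta>)\<close> of \<open>B(0,n)\<close> counts the visits to \<open>I\<^sub>\<beta>\<close> of the points of \<open>I\<^sub>\<alpha>\<^sup>(\<^sup>n\<^sup>)\<close> before
  their return to \<open>I\<^sup>(\<^sup>n\<^sup>)\<close>.  Hence the sum of row \<open>\<alpha>\<close> is the height of a tower of disjoint intervals over
  \<open>I\<^sub>\<alpha>\<^sup>(\<^sup>n\<^sup>)\<close>, and base times height is at most \<open>|I\<^sup>(\<^sup>0\<^sup>)|\<close> (\<open>lengths_pair_row_sums\<close>, obtained by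
  iterating the one-step estimate \<open>rauzy_step_lengths_le\<close>).  If all heights were comparable to the
  largest one, which is \<open>\<parallel>B(0,n)\<parallel>\<close>, every \<open>|I\<^sub>\<alpha>\<^sup>(\<^sup>n\<^sup>)|\<close> would be at most a constant times
  \<open>|I\<^sup>(\<^sup>0\<^sup>)| \<parallel>B(0,n)\<parallel>\<^sup>-\<^sup>1\<close>.  It therefore suffices that the heights agree up to a factor
  \<open>O(\<parallel>B(0,n)\<parallel>\<^sup>\<tau>)\<close>; this is \<open>row_sums_comparable\<close>.

  Up to constants the vector of heights \<open>B(0,n) 1\<close> may be replaced by \<open>W\<^sub>n = B(0,n) v\<close> with \<open>v\<close> a fixed
  element of \<open>\<C>(\<pi>\<^sup>(\<^sup>0\<^sup>))\<close>, a cone that is nonempty because \<open>\<pi>\<close> is irreducible (\<open>cone_of_nonempty\<close>).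
  The contraction property makes each \<open>B(n\<^sub>k, n\<^sub>k\<^sub>+\<^sub>1) v\<close> positive for all nonzero \<open>v\<close> in the closed cone.
  Since the matrix has natural entries, only the supports of its rows matter for a lower bound, so
  that compactness of the unit sphere and finiteness of the set of pairs and supports give one
  constant \<open>c\<close> with \<open>(B(n\<^sub>k, n\<^sub>k\<^sub>+\<^sub>1) v)\<^sub>\<alpha> \<ge> c v\<^sub>\<beta>\<close> for all \<open>k\<close> and all letters (\<open>contraction_balances\<close>).
  For \<open>n\<^sub>k\<^sub>+\<^sub>1 \<le> n < n\<^sub>k\<^sub>+\<^sub>2\<close> all entries of \<open>W\<^sub>n\<close> are then at least \<open>c\<close> times the largest entry of
  \<open>W\<close> at time \<open>n\<^sub>k\<close>, and at most \<open>\<parallel>B(n\<^sub>k, n)\<parallel>\<close> times it.  The norm is controlled by two successive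
  uses of the growth condition, each costing a factor \<open>O(\<parallel>B(0,n)\<parallel>\<^sup>\<tau>\<^sup>/\<^sup>2)\<close>.
\<close>

section \<open>Interval exchanges and their first return maps\<close>

lemma is_iem_bij:
  fixes S :: "'a::finite iem"
  assumes "is_iem S"
  shows "bij_betw (fst (perm S)) UNIV {1..CARD('a)}" "bij_betw (snd (perm S)) UNIV {1..CARD('a)}"
    "0 < len S \<alpha>"
  using assms by (auto simp: is_iem_def irreducible_pair_def)

lemma bij_rank_bounds:
  fixes p :: "'a::finite \<Rightarrow> nat"
  assumes "bij_betw p UNIV {1..CARD('a)}"
  shows "1 \<le> p \<alpha>" "p \<alpha> \<le> CARD('a)" "p \<alpha> = p \<beta> \<longleftrightarrow> \<alpha> = \<beta>"
  using assms bij_betw_apply[OF assms, of \<alpha>] by (auto simp: bij_betw_def inj_def)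

lemma rank_sum_step:
  fixes p :: "'a::finite \<Rightarrow> nat" and l :: "'a \<Rightarrow> real"
  assumes "bij_betw p UNIV {1..CARD('a)}"
  shows "(\<Sum>\<beta> | p \<beta> \<le> p \<alpha>. l \<beta>) = (\<Sum>\<beta> | p \<beta> \<le> p \<alpha> - 1. l \<beta>) + l \<alpha>"
proof -
  have "{\<beta>. p \<beta> \<le> p \<alpha>} = insert \<alpha> {\<beta>. p \<beta> \<le> p \<alpha> - 1}"
  proof (intro set_eqI)
      fix \<beta>
      have "p \<beta> \<le> p \<alpha> \<longleftrightarrow> p \<beta> = p \<alpha> \<or> p \<beta> \<le> p \<alpha> - 1"
        using bij_rank_bounds(1)[OF assms, of \<alpha>] by linarith
      then show "\<beta> \<in> {\<beta>. p \<beta> \<le> p \<alpha>} \<longleftrightarrow> \<beta> \<in> insert \<alpha> {\<beta>. p \<beta> \<le> p \<alpha> - 1}"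
        using bij_rank_bounds(3)[OF assms, of \<beta> \<alpha>] by auto
    qed
  moreover have "\<alpha> \<notin> {\<beta>. p \<beta> \<le> p \<alpha> - 1}"
    using bij_rank_bounds(1)[OF assms, of \<alpha>] by auto
  ultimately show ?thesis by simp
qed

lemma u_top_step:
  assumes "is_iem S"
  shows "u_top S (fst (perm S) \<alpha>) = u_top S (fst (perm S) \<alpha> - 1) + len S \<alpha>"
  using rank_sum_step[OF is_iem_bij(1)[OF assms]] by (simp add: u_top_def)

lemma u_bot_step:
  assumes "is_iem S"
  shows "u_bot S (snd (perm S) \<alpha>) = u_bot S (snd (perm S) \<alpha> - 1) + len S \<alpha>"
  using rank_sum_step[OF is_iem_bij(2)[OF assms]] by (simp add: u_bot_def)

lemma u_mono:
  assumes "is_iem S" "i \<le> j"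
  shows "u_top S i \<le> u_top S j" "u_bot S i \<le> u_bot S j"
proof -
  have nonneg: "0 \<le> len S \<alpha>" for \<alpha> using is_iem_bij(3)[OF assms(1), of \<alpha>] by simp
  show "u_top S i \<le> u_top S j" unfolding u_top_def
    using assms(2) nonneg by (intro add_left_mono sum_mono2) auto
  show "u_bot S i \<le> u_bot S j" unfolding u_bot_def
    using assms(2) nonneg by (intro add_left_mono sum_mono2) auto
qed

lemma u_0:
  assumes "is_iem S"
  shows "u_top S 0 = base S" "u_bot S 0 = base S"
proof -
  have no: "\<not> fst (perm S) \<alpha> \<le> 0" "\<not> snd (perm S) \<alpha> \<le> 0" for \<alpha>
    using bij_rank_bounds(1)[OF is_iem_bij(1)[OF assms], of \<alpha>]
      bij_rank_bounds(1)[OF is_iem_bij(2)[OF assms], of \<alpha>] by linarith+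
  show "u_top S 0 = base S" "u_bot S 0 = base S"
    unfolding u_top_def u_bot_def using no by (simp_all only: Collect_empty_eq[THEN iffD2] sum.empty) simp_all
qed

lemma u_CARD:
  fixes S :: "'a::finite iem"
  assumes "is_iem S"
  shows "u_top S CARD('a) = base S + total_len S" "u_bot S CARD('a) = base S + total_len S"
  using bij_rank_bounds(2)[OF is_iem_bij(1)[OF assms]] bij_rank_bounds(2)[OF is_iem_bij(2)[OF assms]]
  by (simp_all add: u_top_def u_bot_def total_len_def)

lemma I_top_unique:
  assumes S: "is_iem S" and x: "x \<in> I_top S \<alpha>" "x \<in> I_top S \<beta>"
  shows "\<alpha> = \<beta>"
proof (rule ccontr)
  assume "\<alpha> \<noteq> \<beta>"
  have *: "\<not> (x \<in> I_top S \<gamma> \<and> x \<in> I_top S \<delta>)"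
    if "fst (perm S) \<gamma> < fst (perm S) \<delta>" for \<gamma> \<delta>
  proof -
    have "fst (perm S) \<gamma> \<le> fst (perm S) \<delta> - 1" using that by linarith
    from u_mono(1)[OF S this] show ?thesis by (auto simp: I_top_def)
  qed
  have "fst (perm S) \<alpha> \<noteq> fst (perm S) \<beta>"
    using \<open>\<alpha> \<noteq> \<beta>\<close> bij_rank_bounds(3)[OF is_iem_bij(1)[OF S]] by blast
  then show False using * x by (metis linorder_neqE_nat)
qed

lemma I_top_cover:
  fixes S :: "'a::finite iem"
  assumes S: "is_iem S" and x: "base S \<le> x" "x < u_top S CARD('a)"
  shows "\<exists>\<alpha>. x \<in> I_top S \<alpha>"
proof -
  define i where "i = (LEAST i. x < u_top S i)"
  have i: "x < u_top S i" unfolding i_def using x(2) by (rule LeastI)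
  have "i \<le> CARD('a)" unfolding i_def using x(2) by (rule Least_le)
  moreover have "i \<noteq> 0" using i x(1) u_0(1)[OF S] by (metis not_less)
  ultimately have "i \<in> {1..CARD('a)}" by auto
  then obtain \<alpha> where \<alpha>: "fst (perm S) \<alpha> = i"
    using is_iem_bij(1)[OF S] by (metis bij_betw_iff_bijections)
  have "\<not> x < u_top S (i - 1)"
    using not_less_Least[of "i - 1" "\<lambda>i. x < u_top S i"] \<open>i \<noteq> 0\<close> unfolding i_def by simp
  then have "x \<in> I_top S \<alpha>" using i \<alpha> by (simp add: I_top_def)
  then show ?thesis ..
qed

lemma I_top_subset:
  fixes S :: "'a::finite iem"
  assumes S: "is_iem S"
  shows "I_top S \<alpha> \<subseteq> {base S ..< u_top S CARD('a)}"
  using u_mono(1)[OF S, of 0 "fst (perm S) \<alpha> - 1"] u_0(1)[OF S]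
    u_mono(1)[OF S, of "fst (perm S) \<alpha>" "CARD('a)"] bij_rank_bounds(2)[OF is_iem_bij(1)[OF S], of \<alpha>]
  by (auto simp: I_top_def)

lemma I_top_eq:
  assumes "is_iem S"
  obtains a where "I_top S \<alpha> = {a ..< a + len S \<alpha>}"
  using u_top_step[OF assms] by (metis I_top_def)

lemma len_le_of_subset:
  assumes "is_iem S" "I_top S \<alpha> \<subseteq> {a ..< b}"
  shows "len S \<alpha> \<le> b - a"
proof -
  obtain c where "I_top S \<alpha> = {c ..< c + len S \<alpha>}" using I_top_eq[OF assms(1)] .
  with assms(2) is_iem_bij(3)[OF assms(1), of \<alpha>] show ?thesis by auto
qed

lemma len_add_le_of_subset:
  assumes S: "is_iem S" and "\<alpha> \<noteq> \<beta>" and sub: "I_top S \<alpha> \<subseteq> {a ..< b}" "I_top S \<beta> \<subseteq> {a ..< b}"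
  shows "len S \<alpha> + len S \<beta> \<le> b - a"
proof -
  obtain c d where cd: "I_top S \<alpha> = {c ..< c + len S \<alpha>}" "I_top S \<beta> = {d ..< d + len S \<beta>}"
    using I_top_eq[OF S] by metis
  have pos: "0 < len S \<alpha>" "0 < len S \<beta>" using is_iem_bij(3)[OF S] by auto
  have "max c d \<notin> I_top S \<alpha> \<inter> I_top S \<beta>" using I_top_unique[OF S] \<open>\<alpha> \<noteq> \<beta>\<close> by blast
  then have "c + len S \<alpha> \<le> d \<or> d + len S \<beta> \<le> c" using cd pos by (auto simp: max_def split: if_splits)
  moreover have "a \<le> c" "c + len S \<alpha> \<le> b" "a \<le> d" "d + len S \<beta> \<le> b"
    using sub cd pos by auto
  ultimately show ?thesis by linarith
qed

lemma iem_map_eq: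
  assumes "is_iem S" "x \<in> I_top S \<alpha>"
  shows "iem_map S x = x + (u_bot S (snd (perm S) \<alpha> - 1) - u_top S (fst (perm S) \<alpha> - 1))"
proof -
  have "(THE \<beta>. x \<in> I_top S \<beta>) = \<alpha>" using assms I_top_unique by blast
  then show ?thesis by (simp add: iem_map_def)
qed

lemma iem_map_bounds:
  assumes S: "is_iem S" and x: "x \<in> I_top S \<alpha>"
  shows "u_bot S (snd (perm S) \<alpha> - 1) \<le> iem_map S x" "iem_map S x < u_bot S (snd (perm S) \<alpha>)"
  using iem_map_eq[OF assms] x u_top_step[OF S, of \<alpha>] u_bot_step[OF S, of \<alpha>] by (auto simp: I_top_def)

lemma last_letters:
  fixes \<pi> :: "'a::finite pair_data"
  assumes "irreducible_pair \<pi>"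
  shows "fst \<pi> \<alpha> = CARD('a) \<longleftrightarrow> \<alpha> = last_top \<pi>" "snd \<pi> \<alpha> = CARD('a) \<longleftrightarrow> \<alpha> = last_bot \<pi>"
proof -
  have *: "p \<alpha> = CARD('a) \<longleftrightarrow> \<alpha> = (THE \<alpha>. p \<alpha> = CARD('a))"
    if p: "bij_betw p UNIV {1..CARD('a)}" for p :: "'a \<Rightarrow> nat"
  proof -
    have "CARD('a) \<in> {1..CARD('a)}" by (simp add: Suc_le_eq)
    then obtain \<beta> where \<beta>: "p \<beta> = CARD('a)" using p by (metis bij_betw_iff_bijections)
    have "(THE \<alpha>. p \<alpha> = CARD('a)) = \<beta>" using \<beta> bij_rank_bounds(3)[OF p] by (intro the_equality) metis+
    then show ?thesis using \<beta> bij_rank_bounds(3)[OF p] by metis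
  qed
  show "fst \<pi> \<alpha> = CARD('a) \<longleftrightarrow> \<alpha> = last_top \<pi>" "snd \<pi> \<alpha> = CARD('a) \<longleftrightarrow> \<alpha> = last_bot \<pi>"
    using * assms unfolding last_top_def last_bot_def irreducible_pair_def by blast+
qed

lemma last_letters_neq:
  fixes \<pi> :: "'a::finite pair_data"
  assumes \<pi>: "irreducible_pair \<pi>" and d: "2 \<le> CARD('a)"
  shows "last_top \<pi> \<noteq> last_bot \<pi>"
proof
  assume eq: "last_top \<pi> = last_bot \<pi>"
  have b: "bij_betw (fst \<pi>) UNIV {1..CARD('a)}" "bij_betw (snd \<pi>) UNIV {1..CARD('a)}"
    using \<pi> by (auto simp: irreducible_pair_def)
  have *: "p -` {1..CARD('a) - 1} = {\<alpha>. p \<alpha> \<noteq> CARD('a)}"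
    if p: "bij_betw p UNIV {1..CARD('a)}" for p :: "'a \<Rightarrow> nat"
  proof -
    have "p \<alpha> \<in> {1..CARD('a) - 1} \<longleftrightarrow> p \<alpha> \<noteq> CARD('a)" for \<alpha>
      using bij_rank_bounds(1,2)[OF p, of \<alpha>] d unfolding atLeastAtMost_iff by linarith
    then show ?thesis by blast
  qed
  have "fst \<pi> -` {1..CARD('a) - 1} = snd \<pi> -` {1..CARD('a) - 1}"
    unfolding *[OF b(1)] *[OF b(2)] using last_letters[OF \<pi>] eq by metis
  moreover have "1 \<le> CARD('a) - 1 \<and> CARD('a) - 1 < CARD('a)" using d by linarith
  ultimately show False using \<pi> unfolding irreducible_pair_def by blast
qed

text \<open>The visit counts determine where the new intervals lie.  A new interval other than the loser's
  lies in the old one with the same label.  A point of the loser's new interval that starts in the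
  winner's old interval must leave \<open>J\<close> at once, in order to visit the loser's interval before it
  returns.  In type \<open>Top\<close> the part outside \<open>J\<close> is the image of the loser's interval, so such points
  do not exist and the winner's interval merely loses its part outside \<open>J\<close>; in type \<open>Bot\<close> the part
  outside \<open>J\<close> is the loser's interval itself, so that both new intervals fit into the winner's old
  one, and the map translates the loser's new interval into the loser's old one.\<close>

lemma rauzy_step_lengths_le:
  fixes S S' :: "'a::finite iem"
  assumes d: "2 \<le> CARD('a)" and S: "is_iem S" and step: "rauzy_step S S'"
  shows "(\<Sum>\<alpha>\<in>UNIV. len S' \<alpha> * arrow_matrix (arrow_of S) $ \<alpha> $ \<beta>) \<le> len S \<beta>"
proof -
  define e where "e = max (u_top S (CARD('a) - 1)) (u_bot S (CARD('a) - 1))"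
  define J where "J = {base S ..< e}"
  define w where "w = winner (arrow_of S)"
  define l where "l = loser (arrow_of S)"
  define N where "N = arrow_matrix (arrow_of S)"
  have S': "is_iem S'" and base': "base S' = base S" and end': "u_top S' CARD('a) = e"
    and visits: "\<And>\<alpha> \<beta> x. x \<in> I_top S' \<alpha> \<Longrightarrow>
      real (card {j. j < return_time (iem_map S) J x \<and> (iem_map S ^^ j) x \<in> I_top S \<beta>}) = N $ \<alpha> $ \<beta>"
    using step unfolding rauzy_step_def Let_def e_def[symmetric] J_def[symmetric] N_def[symmetric]
    by auto
  have irr: "irreducible_pair (perm S)" using S by (simp add: is_iem_def)
  have lw: "l \<noteq> w"
    using last_letters_neq[OF irr d] by (auto simp: l_def w_def loser_def winner_def arrow_of_def split: arrow_type.splits)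
  have N: "N $ \<alpha> $ \<beta> = (if \<alpha> = \<beta> \<or> \<alpha> = l \<and> \<beta> = w then 1 else 0)" for \<alpha> \<beta>
    using lw by (auto simp: N_def arrow_matrix_def mat_def l_def w_def)
  have e_le: "e \<le> u_top S CARD('a)"
    using u_mono[OF S, of "CARD('a) - 1" "CARD('a)"] u_CARD[OF S] by (simp add: e_def)
  have in_J: "x \<in> J" if "x \<in> I_top S' \<alpha>" for x \<alpha>
    using I_top_subset[OF S', of \<alpha>] that base' end' by (auto simp: J_def)
  have first_visit: "x \<in> I_top S \<alpha> \<or> \<alpha> = l \<and> x \<in> I_top S w" if x: "x \<in> I_top S' \<alpha>" for x \<alpha>
  proof -
    obtain \<beta> where \<beta>: "x \<in> I_top S \<beta>"
      using I_top_cover[OF S, of x] in_J[OF x] e_le by (force simp: J_def)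
    \<comment> \<open>The return time is an unspecified number if there is no return, but it cannot vanish
      because the orbit segment visits the interval labelled \<open>\<alpha>\<close>.\<close>
    have "return_time (iem_map S) J x \<noteq> 0"
    proof
      assume "return_time (iem_map S) J x = 0"
      with visits[OF x, of \<alpha>] N show False by simp
    qed
    then have "0 \<in> {j. j < return_time (iem_map S) J x \<and> (iem_map S ^^ j) x \<in> I_top S \<beta>}" using \<beta> by simp
    moreover have "finite {j. j < return_time (iem_map S) J x \<and> (iem_map S ^^ j) x \<in> I_top S \<beta>}" by simp
    ultimately have "0 < card {j. j < return_time (iem_map S) J x \<and> (iem_map S ^^ j) x \<in> I_top S \<beta>}"
      using card_gt_0_iff by blast
    then have "N $ \<alpha> $ \<beta> \<noteq> 0" using visits[OF x, of \<beta>] by linarith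
    then show ?thesis using \<beta> by (auto simp: N split: if_splits)
  qed
  have sub: "I_top S' \<alpha> \<subseteq> I_top S \<alpha>" if "\<alpha> \<noteq> l" for \<alpha> using first_visit that by blast
  have top_l: "fst (perm S) (last_top (perm S)) = CARD('a)" "snd (perm S) (last_bot (perm S)) = CARD('a)"
    using last_letters[OF irr] by auto
  have I_eq: "I_top S \<alpha> = {u_top S (fst (perm S) \<alpha> - 1) ..< u_top S (fst (perm S) \<alpha> - 1) + len S \<alpha>}" for \<alpha>
    using u_top_step[OF S, of \<alpha>] by (simp add: I_top_def)
  have le: "len S' \<alpha> \<le> len S \<alpha>" if "I_top S' \<alpha> \<subseteq> I_top S \<alpha>" for \<alpha>
    using len_le_of_subset[OF S' that[unfolded I_eq[of \<alpha>]]] by simp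
  \<comment> \<open>The count of visits to the loser's interval is 1 and time 0 does not contribute.\<close>
  have leaves: "e \<le> iem_map S x" if x: "x \<in> I_top S' l" and nl: "x \<notin> I_top S l" for x
  proof -
    have xw: "x \<in> I_top S w" using first_visit[OF x] nl by simp
    have "{j. j < return_time (iem_map S) J x \<and> (iem_map S ^^ j) x \<in> I_top S l} \<noteq> {}"
    proof
      assume "{j. j < return_time (iem_map S) J x \<and> (iem_map S ^^ j) x \<in> I_top S l} = {}"
      with visits[OF x, of l] show False unfolding N by simp
    qed
    then obtain j where j: "j < return_time (iem_map S) J x" "(iem_map S ^^ j) x \<in> I_top S l" by blast
    have "j \<noteq> 0" using j(2) nl by (metis funpow_0)
    then have "1 < return_time (iem_map S) J x" using j(1) by simp
    then have "iem_map S x \<notin> J"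
      unfolding return_time_def by (auto dest!: not_less_Least)
    moreover have "base S \<le> iem_map S x"
      using iem_map_bounds(1)[OF S xw] u_mono(2)[OF S, of 0] u_0(2)[OF S] by (metis le0 order_trans)
    ultimately show ?thesis by (simp add: J_def)
  qed
  have "len S' l \<le> len S l \<and> len S' w + len S' l \<le> len S w"
  proof (cases "u_top S (CARD('a) - 1) < u_bot S (CARD('a) - 1)")
    case True
    then have lw_eq: "w = last_top (perm S)" "l = last_bot (perm S)"
      by (simp_all add: w_def l_def winner_def loser_def arrow_of_def)
    have e: "e = u_bot S (CARD('a) - 1)" using True by (simp add: e_def)
    have "x \<in> I_top S l" if x: "x \<in> I_top S' l" for x
    proof (rule ccontr)
      assume "x \<notin> I_top S l"
      then have xw: "x \<in> I_top S w" using first_visit[OF x] by simp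
      have "e \<le> iem_map S x" using leaves[OF x \<open>x \<notin> I_top S l\<close>] .
      moreover have "snd (perm S) w \<noteq> CARD('a)" using last_letters(2)[OF irr, of w] lw lw_eq by simp
      then have "snd (perm S) w \<le> CARD('a) - 1"
        using bij_rank_bounds(2)[OF is_iem_bij(2)[OF S], of w] by linarith
      then have "iem_map S x < e"
        unfolding e using iem_map_bounds(2)[OF S xw] u_mono(2)[OF S] by (metis less_le_trans)
      ultimately show False by simp
    qed
    then have l: "len S' l \<le> len S l" using le by blast
    have "I_top S' w \<subseteq> {u_top S (CARD('a) - 1) ..< e}"
      using sub[of w] lw in_J[of _ w] unfolding I_eq[of w] by (force simp: J_def lw_eq top_l)
    then have "len S' w \<le> e - u_top S (CARD('a) - 1)" by (rule len_le_of_subset[OF S'])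
    moreover have "u_top S CARD('a) = u_top S (CARD('a) - 1) + len S w"
      "u_bot S CARD('a) = e + len S l"
      using u_top_step[OF S, of w] u_bot_step[OF S, of l] top_l by (simp_all add: lw_eq e)
    ultimately show ?thesis using l u_CARD[OF S] by simp
  next
    case False
    then have lw_eq: "w = last_bot (perm S)" "l = last_top (perm S)"
      by (simp_all add: w_def l_def winner_def loser_def arrow_of_def)
    have e: "e = u_top S (CARD('a) - 1)" using False by (simp add: e_def)
    have "I_top S l \<inter> J = {}" unfolding I_eq[of l] by (auto simp: J_def e lw_eq top_l)
    then have "I_top S' l \<subseteq> I_top S w" using first_visit in_J by blast
    then have w: "len S' w + len S' l \<le> len S w"
      using len_add_le_of_subset[OF S' lw[symmetric], of "u_top S (fst (perm S) w - 1)"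
          "u_top S (fst (perm S) w - 1) + len S w"] sub[of w] lw unfolding I_eq[of w] by simp
    define \<delta> where "\<delta> = u_bot S (snd (perm S) w - 1) - u_top S (fst (perm S) w - 1)"
    have "I_top S' l \<subseteq> {e - \<delta> ..< u_bot S CARD('a) - \<delta>}"
    proof
      fix x assume x: "x \<in> I_top S' l"
      then have xw: "x \<in> I_top S w" and "x \<notin> I_top S l"
        using \<open>I_top S' l \<subseteq> I_top S w\<close> I_top_unique[OF S] lw by blast+
      then have "e \<le> iem_map S x" using leaves[OF x] by simp
      moreover have "iem_map S x < u_bot S CARD('a)"
        using iem_map_bounds(2)[OF S xw] by (simp add: lw_eq top_l)
      ultimately show "x \<in> {e - \<delta> ..< u_bot S CARD('a) - \<delta>}"
        using iem_map_eq[OF S xw] by (simp add: \<delta>_def)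
    qed
    then have "len S' l \<le> (u_bot S CARD('a) - \<delta>) - (e - \<delta>)" by (rule len_le_of_subset[OF S'])
    moreover have "u_top S CARD('a) = e + len S l"
      using u_top_step[OF S, of l] top_l by (simp add: lw_eq e)
    ultimately show ?thesis using w u_CARD[OF S] by simp
  qed
  moreover have "(\<Sum>\<alpha>\<in>UNIV. len S' \<alpha> * N $ \<alpha> $ \<beta>) = len S' \<beta> + (if \<beta> = w then len S' l else 0)"
  proof -
    have "(\<Sum>\<alpha>\<in>UNIV. len S' \<alpha> * N $ \<alpha> $ \<beta>) =
      (\<Sum>\<alpha>\<in>UNIV. (if \<alpha> = \<beta> then len S' \<alpha> else 0) + (if \<alpha> = l then if \<beta> = w then len S' \<alpha> else 0 else 0))"
      using lw by (intro sum.cong) (auto simp: N)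
    then show ?thesis by (simp add: sum.distrib)
  qed
  ultimately show ?thesis using le[OF sub, of \<beta>] lw unfolding N_def[symmetric] by auto
qed


section \<open>Positive vectors in the image of the intersection matrix\<close>

text \<open>The letters of \<open>p\<close>-rank above \<open>i\<close> carry the largest values that \<open>p\<close> can take, and \<open>q\<close> gives the
  same sum only if it ranks the same letters above \<open>i\<close>.  After subtraction of the half-integer
  \<open>i + 1/2\<close> the letters of \<open>q\<close>-rank above \<open>i\<close> are exactly those with a positive term, so any other set
  of letters has a strictly smaller sum.\<close>

lemma rank_sum_less:
  fixes p q :: "'a::finite \<Rightarrow> nat"
  assumes p: "bij_betw p UNIV {1..CARD('a)}" and q: "bij_betw q UNIV {1..CARD('a)}"
    and neq: "{\<beta>. i < p \<beta>} \<noteq> {\<beta>. i < q \<beta>}"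
  shows "(\<Sum>\<beta> | i < p \<beta>. real (q \<beta>)) < (\<Sum>\<beta> | i < p \<beta>. real (p \<beta>))"
proof -
  define g where "g x = real x - real i - 1/2" for x :: nat
  have restrict: "(\<Sum>\<beta> | i < p \<beta>. f \<beta>) = (\<Sum>\<beta>\<in>UNIV. if i < p \<beta> then f \<beta> else 0)" for f :: "'a \<Rightarrow> real"
    by (simp add: sum.If_cases)
  obtain \<beta>\<^sub>0 where \<beta>\<^sub>0: "(i < p \<beta>\<^sub>0) \<noteq> (i < q \<beta>\<^sub>0)" using neq by blast
  have "(\<Sum>\<beta>\<in>UNIV. if i < p \<beta> then g (q \<beta>) else 0) < (\<Sum>\<beta>\<in>UNIV. if i < q \<beta> then g (q \<beta>) else 0)"
  proof (rule sum_strict_mono_ex1)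
    show "\<exists>\<beta>\<in>UNIV. (if i < p \<beta> then g (q \<beta>) else 0) < (if i < q \<beta> then g (q \<beta>) else 0)"
      using \<beta>\<^sub>0 by (intro bexI[of _ \<beta>\<^sub>0]) (auto simp: g_def)
  qed (auto simp: g_def)
  also have "\<dots> = (\<Sum>x\<in>{1..CARD('a)}. if i < x then g x else 0)"
    by (rule sum.reindex_bij_betw[OF q])
  also have "\<dots> = (\<Sum>\<beta>\<in>UNIV. if i < p \<beta> then g (p \<beta>) else 0)"
    by (rule sum.reindex_bij_betw[OF p, symmetric])
  finally have "(\<Sum>\<beta> | i < p \<beta>. g (q \<beta>)) < (\<Sum>\<beta> | i < p \<beta>. g (p \<beta>))"
    unfolding restrict .
  then show ?thesis by (simp add: g_def sum_subtractf)
qed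

text \<open>The witness is the image of \<open>\<tau> = \<pi>\<^sub>t - \<pi>\<^sub>b\<close>, that is, the canonical suspension data up to sign.
  As \<open>\<Omega>\<^sub>\<alpha>\<^sub>\<beta>\<close> is a difference of the indicators of \<open>\<pi>\<^sub>t(\<alpha>) < \<pi>\<^sub>t(\<beta>)\<close> and \<open>\<pi>\<^sub>b(\<alpha>) < \<pi>\<^sub>b(\<beta>)\<close>, each entry of
  \<open>\<Omega> \<tau>\<close> is a sum of two tail sums, one per row of the pair.  By irreducibility a tail sum is
  positive unless the letter is last in that row, and no letter is last in both.\<close>

lemma cone_of_nonempty:
  fixes \<pi> :: "'a::finite pair_data"
  assumes irr: "irreducible_pair \<pi>" and d: "2 \<le> CARD('a)"
  shows "cone_of \<pi> \<noteq> {}"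
proof -
  define p where "p = fst \<pi>"
  define q where "q = snd \<pi>"
  have p: "bij_betw p UNIV {1..CARD('a)}" and q: "bij_betw q UNIV {1..CARD('a)}"
    using irr by (auto simp: irreducible_pair_def p_def q_def)
  define \<tau> :: "real^'a" where "\<tau> = (\<chi> \<beta>. real (p \<beta>) - real (q \<beta>))"
  have Om: "Omega \<pi> $ \<alpha> $ \<beta> = (if p \<alpha> < p \<beta> then 1 else 0) - (if q \<alpha> < q \<beta> then 1 else 0)" for \<alpha> \<beta>
  proof (cases "\<alpha> = \<beta>")
    case False
    then have "p \<alpha> \<noteq> p \<beta>" "q \<alpha> \<noteq> q \<beta>" using bij_rank_bounds(3)[OF p] bij_rank_bounds(3)[OF q] by auto
    then show ?thesis unfolding Omega_def p_def[symmetric] q_def[symmetric] by (simp add: not_less)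
  qed (simp add: Omega_def)
  have tails: "{\<beta>. i < p \<beta>} \<noteq> {\<beta>. i < q \<beta>}" if i: "1 \<le> i" "i < CARD('a)" for i
  proof
    assume eq: "{\<beta>. i < p \<beta>} = {\<beta>. i < q \<beta>}"
    have "r -` {1..i} = - {\<beta>. i < r \<beta>}" if "bij_betw r UNIV {1..CARD('a)}" for r :: "'a \<Rightarrow> nat"
      using bij_rank_bounds(1)[OF that] by auto
    from this[OF p] this[OF q] eq have "p -` {1..i} = q -` {1..i}" by simp
    then show False using irr i by (auto simp: irreducible_pair_def p_def q_def)
  qed
  have pos: "0 < (\<Sum>\<beta> | p \<alpha> < p \<beta>. real (p \<beta>) - real (q \<beta>))" if "p \<alpha> \<noteq> CARD('a)" for \<alpha>
    using rank_sum_less[OF p q tails[of "p \<alpha>"]] bij_rank_bounds(1,2)[OF p, of \<alpha>] that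
    by (simp add: sum_subtractf)
  have neg: "0 < (\<Sum>\<beta> | q \<alpha> < q \<beta>. real (q \<beta>) - real (p \<beta>))" if "q \<alpha> \<noteq> CARD('a)" for \<alpha>
    using rank_sum_less[OF q p tails[of "q \<alpha>", symmetric]] bij_rank_bounds(1,2)[OF q, of \<alpha>] that
    by (simp add: sum_subtractf)
  have zero: "(\<Sum>\<beta> | r \<alpha> < r \<beta>. f \<beta>) = 0" if "bij_betw r UNIV {1..CARD('a)}" "r \<alpha> = CARD('a)"
    for r :: "'a \<Rightarrow> nat" and f :: "'a \<Rightarrow> real" and \<alpha>
  proof -
    have "{\<beta>. r \<alpha> < r \<beta>} = {}" using bij_rank_bounds(2)[OF that(1)] that(2) by (auto simp: not_less)
    then show ?thesis by simp
  qed
  have "(Omega \<pi> *v \<tau>) $ \<alpha> > 0" for \<alpha>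
  proof -
    have "(Omega \<pi> *v \<tau>) $ \<alpha> = (\<Sum>\<beta>\<in>UNIV. (if p \<alpha> < p \<beta> then real (p \<beta>) - real (q \<beta>) else 0)
        + (if q \<alpha> < q \<beta> then real (q \<beta>) - real (p \<beta>) else 0))"
      unfolding matrix_vector_mult_def by (auto simp: Om \<tau>_def intro!: sum.cong)
    also have "\<dots> = (\<Sum>\<beta> | p \<alpha> < p \<beta>. real (p \<beta>) - real (q \<beta>)) + (\<Sum>\<beta> | q \<alpha> < q \<beta>. real (q \<beta>) - real (p \<beta>))"
      by (simp add: sum.distrib sum.If_cases)
    also have "\<dots> > 0"
    proof (cases "p \<alpha> = CARD('a)")
      case True
      then have "q \<alpha> \<noteq> CARD('a)"
        using last_letters[OF irr, of \<alpha>] last_letters_neq[OF irr d] by (auto simp: p_def q_def)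
      then show ?thesis using neg zero[OF p True] by simp
    next
      case False
      then show ?thesis using pos[OF False] neg[of \<alpha>] zero[OF q, of \<alpha>] by (cases "q \<alpha> = CARD('a)") (simp_all add: add_pos_pos)
    qed
    finally show ?thesis .
  qed
  then have "Omega \<pi> *v \<tau> \<in> cone_of \<pi>" by (auto simp: cone_of_def positive_cone_def H_image_def)
  then show ?thesis by blast
qed

section \<open>A uniform positivity bound\<close>

text \<open>Compactness of the unit vectors in the closure of \<open>K\<close>.\<close>

lemma linear_pos_lower_bound:
  fixes f :: "'n::euclidean_space \<Rightarrow> real"
  assumes f: "linear f" and scale: "\<And>v r. v \<in> K \<Longrightarrow> 0 < r \<Longrightarrow> r *\<^sub>R v \<in> K"
    and pos: "\<And>v. v \<in> closure K \<Longrightarrow> v \<noteq> 0 \<Longrightarrow> 0 < f v"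
  shows "\<exists>c>0. \<forall>v\<in>K. c * norm v \<le> f v"
proof -
  define U where "U = closure (K \<inter> sphere 0 1)"
  have sph: "U \<subseteq> sphere 0 1" unfolding U_def by (intro closure_minimal) auto
  have cl: "U \<subseteq> closure K" unfolding U_def by (intro closure_mono) auto
  have "compact U" using sph by (auto simp: U_def intro!: compact_closure[THEN iffD2] bounded_subset[OF bounded_sphere])
  have "\<exists>c>0. \<forall>u\<in>U. c \<le> f u"
  proof (cases "U = {}")
    case True
    then show ?thesis by (auto intro: zero_less_one)
  next
    case False
    obtain u where u: "u \<in> U" "\<And>w. w \<in> U \<Longrightarrow> f u \<le> f w"
      using continuous_attains_inf[OF \<open>compact U\<close> False linear_continuous_on[OF linear_conv_bounded_linear[THEN iffD1, OF f]]]
      by blast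
    have "u \<noteq> 0" using u(1) sph by auto
    then have "0 < f u" using pos u(1) cl by blast
    then show ?thesis using u(2) by blast
  qed
  then obtain c where c: "0 < c" "\<And>u. u \<in> U \<Longrightarrow> c \<le> f u" by blast
  have "c * norm v \<le> f v" if v: "v \<in> K" for v
  proof (cases "v = 0")
    case True
    then show ?thesis using linear_0[OF f] by simp
  next
    case False
    have "(1 / norm v) *\<^sub>R v \<in> K \<inter> sphere 0 1" using False scale[OF v, of "1 / norm v"] by simp
    then have "c \<le> f ((1 / norm v) *\<^sub>R v)" using c(2) closure_subset unfolding U_def by blast
    also have "\<dots> = f v / norm v" by (simp add: linear_scale[OF f])
    finally show ?thesis using False by (simp add: field_simps)
  qed
  then show ?thesis using c(1) by blast
qed

lemma cone_of_scale:
  assumes "v \<in> cone_of \<pi>" "0 < r"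
  shows "r *\<^sub>R v \<in> cone_of \<pi>"
proof -
  obtain u where u: "v = Omega \<pi> *v u" using assms(1) by (auto simp: cone_of_def H_image_def)
  then have "r *\<^sub>R v = Omega \<pi> *v (r *\<^sub>R u)"
    by (simp add: linear_scale[OF matrix_vector_mul_linear])
  then have "r *\<^sub>R v \<in> H_image \<pi>" by (auto simp: H_image_def)
  then show ?thesis using assms by (simp add: cone_of_def positive_cone_def)
qed

lemma finite_irreducible_pairs: "finite {\<pi> :: 'a::finite pair_data. irreducible_pair \<pi>}"
proof -
  define F where "F = PiE (UNIV :: 'a set) (\<lambda>_. {1..CARD('a)})"
  have "finite F" unfolding F_def by (intro finite_PiE) auto
  moreover have "{\<pi> :: 'a pair_data. irreducible_pair \<pi>} \<subseteq> F \<times> F"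
    using bij_betw_apply unfolding irreducible_pair_def F_def by fastforce
  ultimately show ?thesis by (meson finite_SigmaI finite_subset)
qed

text \<open>Here \<open>S\<close> will be the support of a matrix row.  There are finitely many \<open>(\<pi>, S)\<close>, so a single
  constant serves all rows of all the matrices in a path of unbounded length.\<close>

lemma uniform_cone_bound:
  obtains c :: real where "0 < c"
    "\<And>\<pi> S v. irreducible_pair (\<pi> :: 'a::finite pair_data)
      \<Longrightarrow> (\<And>v. v \<in> closure (cone_of \<pi>) \<Longrightarrow> v \<noteq> 0 \<Longrightarrow> 0 < (\<Sum>\<beta>\<in>S. v $ \<beta>))
      \<Longrightarrow> v \<in> cone_of \<pi> \<Longrightarrow> c * norm v \<le> (\<Sum>\<beta>\<in>S. v $ \<beta>)"
proof -
  define P :: "('a pair_data \<times> 'a set) set" where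
    "P = {(\<pi>, S). irreducible_pair \<pi> \<and> (\<forall>v\<in>closure (cone_of \<pi>). v \<noteq> 0 \<longrightarrow> 0 < (\<Sum>\<beta>\<in>S. v $ \<beta>))}"
  have "\<exists>c>0. \<forall>v\<in>cone_of \<pi>. c * norm v \<le> (\<Sum>\<beta>\<in>S. v $ \<beta>)" if "(\<pi>, S) \<in> P" for \<pi> S
  proof (rule linear_pos_lower_bound)
    show "linear (\<lambda>v::real^'a. \<Sum>\<beta>\<in>S. v $ \<beta>)"
      by (intro linearI) (simp_all add: sum.distrib sum_distrib_left)
    show "r *\<^sub>R v \<in> cone_of \<pi>" if "v \<in> cone_of \<pi>" "0 < r" for v r using that by (rule cone_of_scale)
    show "0 < (\<Sum>\<beta>\<in>S. v $ \<beta>)" if "v \<in> closure (cone_of \<pi>)" "v \<noteq> 0" for v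
      using that \<open>(\<pi>, S) \<in> P\<close> by (auto simp: P_def)
  qed
  then have "\<forall>x\<in>P. \<exists>c>0. \<forall>v\<in>cone_of (fst x). c * norm v \<le> (\<Sum>\<beta>\<in>snd x. v $ \<beta>)" by auto
  then obtain k where k: "\<And>x. x \<in> P \<Longrightarrow> 0 < k x"
    "\<And>x v. x \<in> P \<Longrightarrow> v \<in> cone_of (fst x) \<Longrightarrow> k x * norm v \<le> (\<Sum>\<beta>\<in>snd x. v $ \<beta>)"
    by (metis bchoice)
  have "P \<subseteq> {\<pi>. irreducible_pair \<pi>} \<times> UNIV" by (auto simp: P_def)
  then have fin: "finite P"
    by (rule finite_subset) (simp add: finite_irreducible_pairs finite_cartesian_product)
  \<comment> \<open>The element 1 keeps the set nonempty.\<close>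
  define c where "c = Min (insert 1 (k ` P))"
  have "0 < c" unfolding c_def using fin k(1) by (subst Min_gr_iff) auto
  moreover have "c * norm v \<le> (\<Sum>\<beta>\<in>S. v $ \<beta>)"
    if "irreducible_pair \<pi>" "\<And>v. v \<in> closure (cone_of \<pi>) \<Longrightarrow> v \<noteq> 0 \<Longrightarrow> 0 < (\<Sum>\<beta>\<in>S. v $ \<beta>)" "v \<in> cone_of \<pi>"
    for \<pi> :: "'a pair_data" and S v
  proof -
    have in_P: "(\<pi>, S) \<in> P" using that by (auto simp: P_def)
    then have "c \<le> k (\<pi>, S)" unfolding c_def using fin by (intro Min_le) auto
    then have "c * norm v \<le> k (\<pi>, S) * norm v" by (intro mult_right_mono) auto
    also have "\<dots> \<le> (\<Sum>\<beta>\<in>S. v $ \<beta>)" using k(2)[OF in_P] that(3) by simp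
    finally show ?thesis .
  qed
  ultimately show thesis by (rule that)
qed

lemma closure_cone_nonneg:
  assumes "v \<in> closure (cone_of \<pi>)"
  shows "0 \<le> v $ \<alpha>"
proof -
  have "cone_of \<pi> \<subseteq> {v. \<forall>\<alpha>. 0 \<le> v $ \<alpha>}" by (auto simp: cone_of_def positive_cone_def less_imp_le)
  then have "closure (cone_of \<pi>) \<subseteq> {v. \<forall>\<alpha>. 0 \<le> v $ \<alpha>}"
    by (intro closure_minimal closed_positive_orthant)
  then show ?thesis using assms by blast
qed

section \<open>Products of step matrices\<close>

text \<open>These are the properties of products of step matrices that matter for the estimates:
  natural entries turn a nonzero entry into a lower bound by 1, and dominating the identity makes
  nonnegative vectors grow entrywise.\<close>

definition visit_matrix :: "real^'a::finite^'a \<Rightarrow> bool" where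
  "visit_matrix A \<longleftrightarrow> (\<forall>\<alpha> \<beta>. A $ \<alpha> $ \<beta> \<in> \<nat>) \<and> (\<forall>\<alpha>. 1 \<le> A $ \<alpha> $ \<alpha>)"

lemma visit_matrix_nonneg: "visit_matrix A \<Longrightarrow> 0 \<le> A $ \<alpha> $ \<beta>"
  using Nats_cases unfolding visit_matrix_def by (metis of_nat_0_le_iff)

lemma visit_matrix_one: "visit_matrix (mat 1)"
  by (simp add: visit_matrix_def mat_def)

lemma visit_matrix_arrow: "visit_matrix (arrow_matrix a)"
  by (auto simp: visit_matrix_def arrow_matrix_def mat_def)

lemma visit_matrix_mult:
  fixes A B :: "real^'a::finite^'a"
  assumes A: "visit_matrix A" and B: "visit_matrix B"
  shows "visit_matrix (A ** B)"
proof -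
  have Nats_sum: "(\<Sum>\<gamma>\<in>F. f \<gamma>) \<in> \<nat>" if "finite F" "\<And>\<gamma>. f \<gamma> \<in> \<nat>" for F :: "'a set" and f :: "'a \<Rightarrow> real"
    using that by (induction F rule: finite_induct) (auto intro: Nats_add)
  have "(A ** B) $ \<alpha> $ \<beta> \<in> \<nat>" for \<alpha> \<beta>
    using assms unfolding visit_matrix_def matrix_matrix_mult_def by (auto intro!: Nats_sum Nats_mult)
  moreover have "1 \<le> (A ** B) $ \<alpha> $ \<alpha>" for \<alpha>
  proof -
    have "1 * 1 \<le> A $ \<alpha> $ \<alpha> * B $ \<alpha> $ \<alpha>"
      using assms by (intro mult_mono) (auto simp: visit_matrix_def visit_matrix_nonneg)
    also have "\<dots> \<le> (\<Sum>\<beta>\<in>UNIV. A $ \<alpha> $ \<beta> * B $ \<beta> $ \<alpha>)"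
      by (rule member_le_sum) (auto simp: assms visit_matrix_nonneg)
    finally show ?thesis by (simp add: matrix_matrix_mult_def)
  qed
  ultimately show ?thesis by (simp add: visit_matrix_def)
qed

lemma visit_matrix_B_mat: "visit_matrix (B_mat \<gamma> m n)"
  by (induction n) (auto intro: visit_matrix_one visit_matrix_arrow visit_matrix_mult)

lemma B_mat_refl [simp]: "B_mat \<gamma> m m = mat 1"
  by (cases m) auto

text \<open>The cocycle relation.\<close>

lemma B_mat_comp:
  assumes "k \<le> m" "m \<le> n"
  shows "B_mat \<gamma> k n = B_mat \<gamma> m n ** B_mat \<gamma> k m"
  using assms(2,1)
proof (induction n rule: dec_induct)
  case (step n)
  then show ?case by (simp add: matrix_mul_assoc)
qed simp

lemma mv_sum: "(A *v v) $ \<alpha> = (\<Sum>\<beta>\<in>UNIV. A $ \<alpha> $ \<beta> * v $ \<beta>)"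
  by (simp add: matrix_vector_mult_def)

lemma visit_matrix_mv_mono:
  assumes "visit_matrix A" "\<And>\<beta>. u $ \<beta> \<le> v $ \<beta>"
  shows "(A *v u) $ \<alpha> \<le> (A *v v) $ \<alpha>"
  unfolding mv_sum by (intro sum_mono mult_left_mono assms visit_matrix_nonneg)

lemma visit_matrix_mv_ge:
  assumes A: "visit_matrix A" and v: "\<And>\<beta>. 0 \<le> v $ \<beta>"
  shows "v $ \<alpha> \<le> (A *v v) $ \<alpha>"
proof -
  have "1 * v $ \<alpha> \<le> A $ \<alpha> $ \<alpha> * v $ \<alpha>"
    using A v by (intro mult_right_mono) (auto simp: visit_matrix_def)
  also have "\<dots> \<le> (A *v v) $ \<alpha>" unfolding mv_sum
    by (rule member_le_sum) (auto simp: A v visit_matrix_nonneg)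
  finally show ?thesis by simp
qed

lemma mv_const:
  fixes A :: "real^'a::finite^'a"
  shows "(A *v (\<chi> \<beta>. r)) $ \<alpha> = r * (A *v 1) $ \<alpha>"
  unfolding mv_sum sum_distrib_left by (intro sum.cong) (simp_all add: mult.commute)

lemma visit_matrix_row_sum_ge_1: "visit_matrix A \<Longrightarrow> 1 \<le> (A *v 1) $ \<alpha>"
  using visit_matrix_mv_ge[of A 1] by simp

text \<open>The norm is the largest entry of \<open>A 1\<close>, which reduces norm estimates to entrywise estimates of
  matrices acting on nonnegative vectors.\<close>

lemma mat_norm_visit:
  assumes "visit_matrix A"
  shows "mat_norm A = Max (range (\<lambda>\<alpha>. (A *v 1) $ \<alpha>))"
  using assms by (simp add: mat_norm_def mv_sum visit_matrix_nonneg)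

lemma row_sum_le_mat_norm: "visit_matrix A \<Longrightarrow> (A *v 1) $ \<alpha> \<le> mat_norm A"
  by (simp add: mat_norm_visit)

lemma mat_norm_attained:
  assumes "visit_matrix A"
  obtains \<alpha> where "mat_norm A = (A *v 1) $ \<alpha>"
proof -
  have "Max (range (\<lambda>\<alpha>. (A *v 1) $ \<alpha>)) \<in> range (\<lambda>\<alpha>. (A *v 1) $ \<alpha>)" by (rule Max_in) auto
  then show thesis using that unfolding mat_norm_visit[OF assms] by blast
qed

lemma mat_norm_ge_1: "visit_matrix A \<Longrightarrow> 1 \<le> mat_norm A"
  using row_sum_le_mat_norm visit_matrix_row_sum_ge_1 order_trans by blast

lemma visit_matrix_mv_le:
  assumes A: "visit_matrix A" and v: "\<And>\<beta>. v $ \<beta> \<le> r" and r: "0 \<le> r"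
  shows "(A *v v) $ \<alpha> \<le> mat_norm A * r"
proof -
  have "(A *v v) $ \<alpha> \<le> (A *v (\<chi> \<beta>. r)) $ \<alpha>" by (rule visit_matrix_mv_mono) (use A v in auto)
  also have "\<dots> \<le> r * mat_norm A" unfolding mv_const using row_sum_le_mat_norm[OF A] r by (intro mult_left_mono)
  finally show ?thesis by (simp add: mult.commute)
qed

lemma mat_norm_mult_le:
  assumes A: "visit_matrix A" and B: "visit_matrix B"
  shows "mat_norm (A ** B) \<le> mat_norm A * mat_norm B"
proof -
  obtain \<alpha> where "mat_norm (A ** B) = ((A ** B) *v 1) $ \<alpha>"
    using mat_norm_attained[OF visit_matrix_mult[OF A B]] .
  also have "\<dots> = (A *v (B *v 1)) $ \<alpha>" by (simp add: matrix_vector_mul_assoc)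
  also have "\<dots> \<le> mat_norm A * mat_norm B"
    using row_sum_le_mat_norm[OF B] mat_norm_ge_1[OF B] by (intro visit_matrix_mv_le A) auto
  finally show ?thesis .
qed

lemma mat_norm_mult_ge:
  assumes A: "visit_matrix A" and B: "visit_matrix B"
  shows "mat_norm B \<le> mat_norm (A ** B)"
proof -
  obtain \<alpha> where "mat_norm B = (B *v 1) $ \<alpha>" using mat_norm_attained[OF B] .
  also have "\<dots> \<le> (A *v (B *v 1)) $ \<alpha>"
    using visit_matrix_row_sum_ge_1[OF B] by (intro visit_matrix_mv_ge A) (meson order_trans zero_le_one)
  also have "\<dots> \<le> mat_norm (A ** B)"
    using row_sum_le_mat_norm[OF visit_matrix_mult[OF A B]] by (simp add: matrix_vector_mul_assoc)
  finally show ?thesis .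
qed

lemma mat_norm_B_mat_mono:
  assumes "k \<le> m" "m \<le> n"
  shows "mat_norm (B_mat \<gamma> k m) \<le> mat_norm (B_mat \<gamma> k n)"
  unfolding B_mat_comp[OF assms] by (intro mat_norm_mult_ge visit_matrix_B_mat)

section \<open>Contraction balances the rows\<close>

text \<open>The image could only be \<open>0\<close> besides lying in the cone; this is excluded because the matrix
  dominates the identity.\<close>

lemma contracts_into_cone:
  assumes con: "contracts \<gamma> m n" and v: "v \<in> closure (cone_of (fst (\<gamma> m)))" "v \<noteq> 0"
  shows "B_mat \<gamma> m n *v v \<in> cone_of (fst (\<gamma> n))"
proof -
  have "B_mat \<gamma> m n *v v \<in> closure ((*v) (B_mat \<gamma> m n) ` cone_of (fst (\<gamma> m)))"
    using closure_linear_image_subset[OF matrix_vector_mul_linear[of "B_mat \<gamma> m n"]] v(1) by blast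
  then have "B_mat \<gamma> m n *v v \<in> cone_of (fst (\<gamma> n)) \<union> {0}" using con by (auto simp: contracts_def)
  moreover have "B_mat \<gamma> m n *v v \<noteq> 0"
  proof
    assume 0: "B_mat \<gamma> m n *v v = 0"
    have "v $ \<alpha> \<le> 0" for \<alpha>
      using visit_matrix_mv_ge[OF visit_matrix_B_mat closure_cone_nonneg[OF v(1)], of \<alpha> \<gamma> m n] unfolding 0 by simp
    then have "v = 0" using closure_cone_nonneg[OF v(1)] by (simp add: vec_eq_iff order_antisym)
    then show False using v(2) by blast
  qed
  ultimately show ?thesis by blast
qed

text \<open>Row \<open>\<alpha>\<close> of the matrix is at least 1 on its support \<open>S\<close>, so \<open>(B v)\<^sub>\<alpha>\<close> is at least the sum of \<open>v\<close>
  over \<open>S\<close>.  The two vanish for the same nonnegative \<open>v\<close>, so contraction makes the latter positive on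
  the closed cone and the uniform bound applies to it.\<close>

lemma contraction_balances:
  obtains c :: real where "0 < c"
    "\<And>\<gamma> m n v \<alpha> \<beta>. irreducible_pair (fst (\<gamma> m :: 'a::finite arrow)) \<Longrightarrow> contracts \<gamma> m n
      \<Longrightarrow> v \<in> cone_of (fst (\<gamma> m)) \<Longrightarrow> c * v $ \<beta> \<le> (B_mat \<gamma> m n *v v) $ \<alpha>"
proof -
  obtain c :: real where c: "0 < c"
    "\<And>\<pi> S v. irreducible_pair (\<pi> :: 'a::finite pair_data)
      \<Longrightarrow> (\<And>v. v \<in> closure (cone_of \<pi>) \<Longrightarrow> v \<noteq> 0 \<Longrightarrow> 0 < (\<Sum>\<beta>\<in>S. v $ \<beta>))
      \<Longrightarrow> v \<in> cone_of \<pi> \<Longrightarrow> c * norm v \<le> (\<Sum>\<beta>\<in>S. v $ \<beta>)"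
    using uniform_cone_bound by blast
  have "c * v $ \<beta> \<le> (B_mat \<gamma> m n *v v) $ \<alpha>"
    if irr: "irreducible_pair (fst (\<gamma> m))" and con: "contracts \<gamma> m n" and v: "v \<in> cone_of (fst (\<gamma> m))"
    for \<gamma> :: "nat \<Rightarrow> 'a arrow" and m n v \<alpha> \<beta>
  proof -
    define A where "A = B_mat \<gamma> m n"
    have A: "visit_matrix A" by (simp add: A_def visit_matrix_B_mat)
    define S where "S = {\<beta>. A $ \<alpha> $ \<beta> \<noteq> 0}"
    have A_S: "(A *v u) $ \<alpha> = (\<Sum>\<beta>\<in>S. A $ \<alpha> $ \<beta> * u $ \<beta>)" for u
      unfolding mv_sum by (rule sum.mono_neutral_right) (auto simp: S_def)
    have "0 < (\<Sum>\<beta>\<in>S. u $ \<beta>)" if u: "u \<in> closure (cone_of (fst (\<gamma> m)))" "u \<noteq> 0" for u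
    proof (rule ccontr)
      assume "\<not> 0 < (\<Sum>\<beta>\<in>S. u $ \<beta>)"
      then have "(\<Sum>\<beta>\<in>S. u $ \<beta>) = 0"
        using closure_cone_nonneg[OF u(1)] by (meson not_less order_antisym sum_nonneg)
      then have "\<forall>\<beta>\<in>S. u $ \<beta> = 0"
        using closure_cone_nonneg[OF u(1)] by (subst (asm) sum_nonneg_eq_0_iff) auto
      then have "(A *v u) $ \<alpha> = 0" unfolding A_S by simp
      moreover have "0 < (A *v u) $ \<alpha>"
        using contracts_into_cone[OF con u] by (simp add: A_def cone_of_def positive_cone_def)
      ultimately show False by simp
    qed
    from c(2)[OF irr this v] have "c * norm v \<le> (\<Sum>\<beta>\<in>S. v $ \<beta>)" by blast
    also have "\<dots> \<le> (A *v v) $ \<alpha>"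
      unfolding A_S
    proof (rule sum_mono)
      fix \<beta> assume "\<beta> \<in> S"
      have "A $ \<alpha> $ \<beta> \<in> \<nat>" using A by (simp add: visit_matrix_def)
      then have "1 \<le> A $ \<alpha> $ \<beta>" using \<open>\<beta> \<in> S\<close> by (auto simp: S_def elim!: Nats_cases)
      then show "v $ \<beta> \<le> A $ \<alpha> $ \<beta> * v $ \<beta>"
        using v mult_right_mono[of 1 "A $ \<alpha> $ \<beta>" "v $ \<beta>"] by (simp add: cone_of_def positive_cone_def less_imp_le)
    qed
    finally have "c * norm v \<le> (A *v v) $ \<alpha>" .
    moreover have "c * v $ \<beta> \<le> c * norm v"
      using component_le_norm_cart[of v \<beta>] c(1) by (intro mult_left_mono) auto
    ultimately show ?thesis by (simp add: A_def)
  qed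
  with c(1) show thesis by (rule that)
qed

text \<open>Since the largest entry of \<open>W\<close> at the contraction time before last bounds \<open>W\<^sub>n\<close> from both sides,
  the ratio between the entries of \<open>W\<^sub>n\<close> is controlled by the norm of the product over at most two
  contraction periods.  Each of these norms satisfies the growth condition with exponent
  \<open>\<tau> / 2\<close>.  Times before the first contraction time have bounded norm.\<close>

lemma row_sums_comparable:
  fixes \<gamma> :: "nat \<Rightarrow> 'a::finite arrow"
  assumes d: "2 \<le> CARD('a)" and irr: "\<And>n. irreducible_pair (fst (\<gamma> n))"
    and cond: "condition_a' \<gamma>" and \<tau>: "0 < \<tau>"
  obtains D where "0 < D"
    "\<And>n \<alpha>. mat_norm (B_mat \<gamma> 0 n) \<le> D * (B_mat \<gamma> 0 n *v 1) $ \<alpha> * mat_norm (B_mat \<gamma> 0 n) powr \<tau>"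
proof -
  define B where "B = B_mat \<gamma>"
  define Q where "Q n = mat_norm (B 0 n)" for n
  have visit: "visit_matrix (B m n)" for m n by (simp add: B_def visit_matrix_B_mat)
  have Q1: "1 \<le> Q n" for n by (simp add: Q_def mat_norm_ge_1 visit)
  have Qmono: "Q m \<le> Q n" if "m \<le> n" for m n using that by (simp add: Q_def B_def mat_norm_B_mat_mono)
  have comp: "B k n = B m n ** B k m" if "k \<le> m" "m \<le> n" for k m n using that unfolding B_def by (rule B_mat_comp)
  obtain \<nu> where ct: "contraction_times \<gamma> \<nu>"
    and grow: "\<forall>\<tau>>0. \<exists>C>0. \<forall>k>0. mat_norm (B (\<nu> (k - 1)) (\<nu> k)) \<le> C * mat_norm (B (\<nu> 0) (\<nu> (k - 1))) powr \<tau>"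
    using cond by (auto simp: condition_a'_def B_def)
  have \<nu>0: "\<nu> 0 = 0" and \<nu>S: "\<nu> k < \<nu> (Suc k)" and con: "contracts \<gamma> (\<nu> k) (\<nu> (Suc k))" for k
    using ct by (auto simp: contraction_times_def)
  have \<nu>mono: "strict_mono \<nu>" using \<nu>S by (simp add: strict_mono_Suc_iff)
  obtain C where C: "0 < C" "\<And>k. mat_norm (B (\<nu> k) (\<nu> (Suc k))) \<le> C * Q (\<nu> k) powr (\<tau> / 2)"
  proof -
    obtain C where C: "0 < C"
      "\<forall>k>0. mat_norm (B (\<nu> (k - 1)) (\<nu> k)) \<le> C * mat_norm (B (\<nu> 0) (\<nu> (k - 1))) powr (\<tau> / 2)"
      using grow \<tau> half_gt_zero by blast
    from C(2) have "mat_norm (B (\<nu> k) (\<nu> (Suc k))) \<le> C * Q (\<nu> k) powr (\<tau> / 2)" for k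
      unfolding Q_def by (metis \<nu>0 diff_Suc_1 zero_less_Suc)
    with C(1) show thesis by (rule that)
  qed
  obtain c :: real where c: "0 < c"
    "\<And>\<gamma> m n v \<alpha> \<beta>. irreducible_pair (fst (\<gamma> m :: 'a arrow)) \<Longrightarrow> contracts \<gamma> m n
      \<Longrightarrow> v \<in> cone_of (fst (\<gamma> m)) \<Longrightarrow> c * v $ \<beta> \<le> (B_mat \<gamma> m n *v v) $ \<alpha>"
    using contraction_balances by blast
  obtain v where v: "v \<in> cone_of (fst (\<gamma> 0))" using cone_of_nonempty[OF irr d] by blast
  define a where "a = Min (range (\<lambda>\<beta>. v $ \<beta>))"
  define b where "b = Max (range (\<lambda>\<beta>. v $ \<beta>))"
  have a: "a \<le> v $ \<beta>" and b: "v $ \<beta> \<le> b" for \<beta> by (auto simp: a_def b_def)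
  have "0 < a" using v by (auto simp: a_def cone_of_def positive_cone_def)
  then have "0 < b" using a b by (meson less_le_trans)
  define W where "W n = B 0 n *v v" for n
  have W_lower: "a * (B 0 n *v 1) $ \<alpha> \<le> W n $ \<alpha>" for n \<alpha>
    unfolding W_def mv_const[symmetric] using a by (intro visit_matrix_mv_mono visit) simp
  have W_upper: "W n $ \<alpha> \<le> b * (B 0 n *v 1) $ \<alpha>" for n \<alpha>
    unfolding W_def mv_const[symmetric] using b by (intro visit_matrix_mv_mono visit) simp
  have W_comp: "W n = B m n *v W m" if "m \<le> n" for m n
    using comp[of 0 m n] that by (simp add: W_def matrix_vector_mul_assoc)
  have W_cone: "W (\<nu> k) \<in> cone_of (fst (\<gamma> (\<nu> k)))" for k
  proof (induction k)
    case 0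
    then show ?case using v by (simp add: \<nu>0 W_def B_def)
  next
    case (Suc k)
    have "W (\<nu> k) \<noteq> 0" using Suc by (auto simp: cone_of_def positive_cone_def)
    then show ?case
      using contracts_into_cone[OF con, of "W (\<nu> k)" k] Suc closure_subset W_comp[OF less_imp_le[OF \<nu>S]]
      by (auto simp: B_def)
  qed
  have W_nonneg: "0 \<le> W n $ \<alpha>" for n \<alpha>
    using W_lower[of n \<alpha>] visit_matrix_row_sum_ge_1[OF visit, of 0 n \<alpha>] \<open>0 < a\<close>
    by (meson less_imp_le mult_nonneg_nonneg order_trans zero_le_one)
  have balanced: "c * W (\<nu> k) $ \<beta> \<le> W n $ \<alpha>" if n: "\<nu> (Suc k) \<le> n" for k n \<alpha> \<beta>
  proof -
    have "c * W (\<nu> k) $ \<beta> \<le> W (\<nu> (Suc k)) $ \<alpha>"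
      using c(2)[of \<gamma> "\<nu> k", OF irr con W_cone] W_comp[OF less_imp_le[OF \<nu>S]] by (simp add: B_def)
    also have "\<dots> \<le> W n $ \<alpha>" unfolding W_comp[OF n]
      using W_nonneg by (intro visit_matrix_mv_ge visit)
    finally show ?thesis .
  qed
  \<comment> \<open>The first entry serves the times before \<open>\<nu> 1\<close>, the second one all later times.\<close>
  define D where "D = max C (C * C * b / (c * a))"
  have "0 < D" using C(1) by (simp add: D_def)
  moreover have "Q n \<le> D * (B 0 n *v 1) $ \<alpha> * Q n powr \<tau>" for n \<alpha>
  proof -
    have row1: "1 \<le> (B 0 n *v 1) $ \<alpha>" using visit_matrix_row_sum_ge_1[OF visit] .
    have pow1: "1 \<le> Q n powr \<tau>" using Q1 \<tau> by (simp add: ge_one_powr_ge_zero)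
    show ?thesis
    proof (cases "n < \<nu> 1")
      case True
      have "Q n \<le> Q (\<nu> 1)" using True by (simp add: Qmono)
      also have "\<dots> \<le> C * Q 0 powr (\<tau> / 2)" using C(2)[of 0] by (simp add: Q_def \<nu>0)
      also have "Q 0 = 1" using mat_norm_visit[OF visit, of 0 0] by (simp add: Q_def B_def)
      finally have "Q n \<le> C * 1 * 1" by simp
      also have "\<dots> \<le> D * (B 0 n *v 1) $ \<alpha> * Q n powr \<tau>"
        using row1 pow1 C(1) \<open>0 < D\<close> by (intro mult_mono) (auto simp: D_def)
      finally show ?thesis .
    next
      case False
      obtain k where k: "\<nu> (Suc k) \<le> n" "n < \<nu> (Suc (Suc k))"
      proof -
        define j where "j = (LEAST j. n < \<nu> j)"
        have "n < \<nu> (Suc n)" using strict_mono_imp_increasing[OF \<nu>mono, of "Suc n"] by simp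
        then have j: "n < \<nu> j" unfolding j_def by (rule LeastI)
        have "j \<noteq> 0" "j \<noteq> 1" using j False \<nu>0 by (auto intro: gr0I)
        then obtain k where "j = Suc (Suc k)" by (metis One_nat_def not0_implies_Suc)
        moreover have "\<not> n < \<nu> (Suc k)"
          using not_less_Least[of "Suc k" "\<lambda>j. n < \<nu> j"] calculation unfolding j_def by simp
        ultimately show thesis using that[of k] j by (simp add: not_less)
      qed
      have \<nu>1: "\<nu> k \<le> \<nu> (Suc k)" and \<nu>2: "\<nu> (Suc k) \<le> \<nu> (Suc (Suc k))" and \<nu>n: "\<nu> k \<le> n"
        using \<nu>S[of k] \<nu>S[of "Suc k"] k by simp_all
      have "mat_norm (B (\<nu> k) n) \<le> mat_norm (B (\<nu> k) (\<nu> (Suc (Suc k))))"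
        using k \<nu>n by (simp add: B_def mat_norm_B_mat_mono)
      also have "\<dots> \<le> mat_norm (B (\<nu> (Suc k)) (\<nu> (Suc (Suc k)))) * mat_norm (B (\<nu> k) (\<nu> (Suc k)))"
        unfolding comp[OF \<nu>1 \<nu>2] by (intro mat_norm_mult_le visit)
      also have "\<dots> \<le> (C * Q (\<nu> (Suc k)) powr (\<tau> / 2)) * (C * Q (\<nu> k) powr (\<tau> / 2))"
        using C mat_norm_ge_1[OF visit] by (intro mult_mono C(2)) (auto intro: order_trans[OF zero_le_one])
      also have "\<dots> \<le> (C * Q n powr (\<tau> / 2)) * (C * Q n powr (\<tau> / 2))"
        using C(1) \<tau> Qmono[OF k(1)] Qmono[OF \<nu>n] Q1
        by (intro mult_mono powr_mono2) (auto intro: order_trans[OF zero_le_one])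
      also have "\<dots> = C * C * Q n powr \<tau>"
        by (simp add: powr_add[symmetric] algebra_simps flip: mult.assoc)
      finally have growth: "mat_norm (B (\<nu> k) n) \<le> C * C * Q n powr \<tau>" .
      \<comment> \<open>Compare the largest row, at \<open>\<alpha>'\<close>, with the given row through the entries of \<open>W (\<nu> k)\<close>.\<close>
      obtain \<alpha>' where \<alpha>': "Q n = (B 0 n *v 1) $ \<alpha>'" unfolding Q_def using mat_norm_attained[OF visit] .
      have "a * Q n \<le> W n $ \<alpha>'" using W_lower \<alpha>' by simp
      also have "\<dots> \<le> mat_norm (B (\<nu> k) n) * (W n $ \<alpha> / c)"
        unfolding W_comp[OF \<nu>n]
      proof (rule visit_matrix_mv_le[OF visit])
        show "W (\<nu> k) $ \<beta> \<le> (B (\<nu> k) n *v W (\<nu> k)) $ \<alpha> / c" for \<beta>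
          using balanced[OF k(1), of \<beta> \<alpha>] c(1) unfolding W_comp[OF \<nu>n] by (simp add: field_simps)
        show "0 \<le> (B (\<nu> k) n *v W (\<nu> k)) $ \<alpha> / c"
          using W_nonneg[of n \<alpha>] c(1) unfolding W_comp[OF \<nu>n] by simp
      qed
      also have "\<dots> \<le> (C * C * Q n powr \<tau>) * (b * (B 0 n *v 1) $ \<alpha> / c)"
        using growth W_upper[of n \<alpha>] W_nonneg[of n \<alpha>] c(1)
        by (intro mult_mono divide_right_mono) auto
      finally have "Q n \<le> (C * C * b / (c * a)) * (B 0 n *v 1) $ \<alpha> * Q n powr \<tau>"
        using \<open>0 < a\<close> c(1) by (simp add: field_simps)
      also have "\<dots> \<le> D * (B 0 n *v 1) $ \<alpha> * Q n powr \<tau>"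
        using row1 by (intro mult_right_mono) (auto simp: D_def)
      finally show ?thesis .
    qed
  qed
  ultimately show thesis using that unfolding Q_def B_def by blast
qed

section \<open>Lengths of the exchanged intervals\<close>

text \<open>The pairing of the lengths with the images of a fixed nonnegative vector does not increase
  along the path, because \<open>rauzy_step_lengths_le\<close> moves the matrix of the last step from the
  vector to the lengths.  At time 0 the pairing with the vector \<open>1\<close> is the total length.\<close>

lemma lengths_pair_row_sums:
  fixes T :: "nat \<Rightarrow> 'a::finite iem"
  assumes d: "2 \<le> CARD('a)" and iem: "\<And>n. is_iem (T n)" and step: "\<And>n. rauzy_step (T n) (T (Suc n))"
  shows "(\<Sum>\<alpha>\<in>UNIV. len (T n) \<alpha> * (B_mat (rotation_number T) 0 n *v 1) $ \<alpha>) \<le> total_len (T 0)"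
proof (induction n)
  case 0
  then show ?case by (simp add: total_len_def)
next
  case (Suc n)
  define y where "y = B_mat (rotation_number T) 0 n *v 1"
  define N where "N = arrow_matrix (arrow_of (T n))"
  have y: "0 \<le> y $ \<beta>" for \<beta>
    using visit_matrix_row_sum_ge_1[OF visit_matrix_B_mat] unfolding y_def by (rule order_trans[OF zero_le_one])
  have "(\<Sum>\<alpha>\<in>UNIV. len (T (Suc n)) \<alpha> * (B_mat (rotation_number T) 0 (Suc n) *v 1) $ \<alpha>)
      = (\<Sum>\<alpha>\<in>UNIV. \<Sum>\<beta>\<in>UNIV. len (T (Suc n)) \<alpha> * N $ \<alpha> $ \<beta> * y $ \<beta>)"
    by (simp add: matrix_vector_mul_assoc[symmetric] y_def[symmetric] N_def[symmetric]
        rotation_number_def mv_sum[of N] sum_distrib_left mult.assoc)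
  also have "\<dots> = (\<Sum>\<beta>\<in>UNIV. (\<Sum>\<alpha>\<in>UNIV. len (T (Suc n)) \<alpha> * N $ \<alpha> $ \<beta>) * y $ \<beta>)"
    by (subst sum.swap) (simp add: sum_distrib_right)
  also have "\<dots> \<le> (\<Sum>\<beta>\<in>UNIV. len (T n) \<beta> * y $ \<beta>)"
    unfolding N_def using rauzy_step_lengths_le[OF d iem step] y by (intro sum_mono mult_right_mono)
  also have "\<dots> \<le> total_len (T 0)" using Suc by (simp add: y_def)
  finally show ?case .
qed

theorem corollary3p11:
  fixes T :: "nat \<Rightarrow> 'a::finite iem"
  assumes "CARD('a) \<ge> 2"
    and "is_iem (T 0)"
    and "no_connection (T 0)"
    and "\<And>n. rauzy_step (T n) (T (Suc n))"
    and "condition_a' (rotation_number T)"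
  shows "\<forall>\<tau>>0. \<exists>C>0. \<forall>\<alpha> n.
    len (T n) \<alpha> \<le> C * total_len (T 0) * mat_norm (B_mat (rotation_number T) 0 n) powr (-1 + \<tau>)"
proof (intro allI impI)
  fix \<tau> :: real assume \<tau>: "0 < \<tau>"
  have iem: "is_iem (T n)" for n
    using assms(2) assms(4)[of "n - 1"] by (cases n) (auto simp: rauzy_step_def Let_def)
  have irr: "irreducible_pair (fst (rotation_number T n))" for n
    using iem[of n] by (simp add: rotation_number_def arrow_of_def is_iem_def)
  define B where "B = B_mat (rotation_number T) 0"
  obtain D where D: "0 < D" "\<And>n \<alpha>. mat_norm (B n) \<le> D * (B n *v 1) $ \<alpha> * mat_norm (B n) powr \<tau>"
    using row_sums_comparable[OF assms(1) irr assms(5) \<tau>] unfolding B_def by blast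
  have "len (T n) \<alpha> \<le> D * total_len (T 0) * mat_norm (B n) powr (-1 + \<tau>)" for \<alpha> n
  proof -
    have visit: "visit_matrix (B n)" by (simp add: B_def visit_matrix_B_mat)
    have Q: "1 \<le> mat_norm (B n)" by (rule mat_norm_ge_1[OF visit])
    have rows: "1 \<le> (B n *v 1) $ \<beta>" for \<beta> by (rule visit_matrix_row_sum_ge_1[OF visit])
    have pos: "0 < len (T n) \<beta>" for \<beta> using is_iem_bij(3)[OF iem] .
    have "len (T n) \<alpha> * (B n *v 1) $ \<alpha> \<le> (\<Sum>\<beta>\<in>UNIV. len (T n) \<beta> * (B n *v 1) $ \<beta>)"
      using pos rows by (intro member_le_sum mult_nonneg_nonneg) (auto intro: less_imp_le order_trans[OF zero_le_one])
    also have "\<dots> \<le> total_len (T 0)"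
      unfolding B_def by (rule lengths_pair_row_sums[where T = T, OF assms(1) iem assms(4)])
    finally have total: "len (T n) \<alpha> * (B n *v 1) $ \<alpha> \<le> total_len (T 0)" .
    have "len (T n) \<alpha> * mat_norm (B n) \<le> len (T n) \<alpha> * (D * (B n *v 1) $ \<alpha> * mat_norm (B n) powr \<tau>)"
      using D(2) pos[of \<alpha>] by (intro mult_left_mono) auto
    also have "\<dots> = D * (len (T n) \<alpha> * (B n *v 1) $ \<alpha>) * mat_norm (B n) powr \<tau>" by simp
    also have "\<dots> \<le> D * total_len (T 0) * mat_norm (B n) powr \<tau>"
      using total D(1) by (intro mult_right_mono mult_left_mono) auto
    finally have "len (T n) \<alpha> \<le> D * total_len (T 0) * mat_norm (B n) powr \<tau> / mat_norm (B n)"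
      using Q by (simp add: field_simps)
    also have "\<dots> = D * total_len (T 0) * mat_norm (B n) powr (-1 + \<tau>)"
      using Q by (simp add: powr_diff)
    finally show ?thesis .
  qed
  then show "\<exists>C>0. \<forall>\<alpha> n. len (T n) \<alpha> \<le> C * total_len (T 0) * mat_norm (B_mat (rotation_number T) 0 n) powr (-1 + \<tau>)"
    using D(1) unfolding B_def by blast
qed

end
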